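(* Let $y\in\mathbb R^{d_y}$, and consider linear forward maps with regularization operator equal to the identity. That is, for a matrix $G\in\mathbb R^{d_y\times d_u}$ consider the problem of minimizing $\tfrac12\|y-Gu\|^2+\tfrac12\|u\|^2$, with optimal solution $$u^*(G)=\operatorname*{arg\,min}_{u\in\mathbb R^{d_u}}\Big\{\tfrac12\|y-Gu\|^2+\tfrac12\|u\|^2\Big\}.$$ Then for any zeroth order algorithm $A$ using any $n$ admissible queries $U\in\mathbb R^{d_u\times n}$, where $n\le d_u/2$, it holds that $$\max_{G:\ \|G\|\le2}\ \|A(U,GU,y)-u^*(G)\|>0.1\,\|y\|.$$
   Context: A zeroth order algorithm for inverting a forward map $\mathcal G:\mathbb R^{d_u}\to\mathbb R^{d_y}$ given data $y\in\mathbb R^{d_y}$ is a map $A:(U,Y,y)\mapsto u\in\mathbb R^{d_u}$, where $U=(u_1,\dots,u_n)\in\mathbb R^{d_u\times n}$ are the query points, $Y=(y_1,\dots,y_n)\in\mathbb R^{d_y\times n}$ are the model outputs $y_i=\mathcal G(u_i)$, and $u$ is the output of the algorithm. It is said to use $n$ admissible queries if the query points $u_1,\dots,u_n$ are obtained from an admissible rule, i.e. $u_{i+1}=B\big(y,u_t,\mathcal G(u_t),t\le i\big)$ for some update rule $B$, so that the output on $\mathcal G$ is $A(U,\mathcal G(U),y)$. Here the forward maps are linear, $\mathcal G(u)=Gu$ with $G\in\mathbb R^{d_y\times d_u}$, and $\mathcal G(U)=GU$. Vector norms are Euclidean and matrix norms are spectral norms.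
   Formalization: The claim is proved for y ≠ 0; for y = 0 it fails as stated, since u*(G) = 0 for every G and the algorithm A ≡ 0 has maximal error 0, which is not > 0.1‖y‖ = 0. *)

theory Defs
  imports "HOL-Analysis.Analysis" "HOL-Library.Extended_Real"
begin

text \<open>
  \<open>B y h\<close> is the next query point, given the data \<open>y\<close> and the history
  \<open>h = [(u\<^sub>1, \<G> u\<^sub>1), \<dots>, (u\<^sub>i, \<G> u\<^sub>i)]\<close>, oldest query first. The first query
  is computed from the empty history, hence from \<open>y\<close> alone; since the length of the
  history is available, the rule may differ from step to step.
\<close>

type_synonym ('u, 'y) update_rule = "'y \<Rightarrow> ('u \<times> 'y) list \<Rightarrow> 'u"

text \<open>
  The matrices \<open>U = (u\<^sub>1, \<dots>, u\<^sub>n)\<close> and \<open>Y = (y\<^sub>1, \<dots>, y\<^sub>n)\<close> are represented by the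
  lists of their columns, because \<open>n\<close> is a natural number and may be \<open>0\<close>.
\<close>

type_synonym ('u, 'y) zeroth_order_algorithm = "'u list \<Rightarrow> 'y list \<Rightarrow> 'y \<Rightarrow> 'u"

primrec admissible_queries ::
    "('u, 'y) update_rule \<Rightarrow> 'y \<Rightarrow> ('u \<Rightarrow> 'y) \<Rightarrow> nat \<Rightarrow> 'u list" where
  "admissible_queries B y \<G> 0 = []"
| "admissible_queries B y \<G> (Suc i) =
     admissible_queries B y \<G> i @
       [B y (map (\<lambda>u. (u, \<G> u)) (admissible_queries B y \<G> i))]"

definition algorithm_output ::
    "('u, 'y) zeroth_order_algorithm \<Rightarrow> ('u, 'y) update_rule \<Rightarrow> nat \<Rightarrow> 'y \<Rightarrow> ('u \<Rightarrow> 'y) \<Rightarrow> 'u" where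
  "algorithm_output A B n y \<G> =
     (let U = admissible_queries B y \<G> n in A U (map \<G> U) y)"

definition objective :: "real ^ 'dy \<Rightarrow> real ^ 'du ^ 'dy \<Rightarrow> real ^ 'du \<Rightarrow> real" where
  "objective y G u = 1/2 * (norm (y - G *v u))\<^sup>2 + 1/2 * (norm u)\<^sup>2"

text \<open>The objective is strictly convex and coercive, so its minimizer exists and is unique.\<close>

definition optimal_solution :: "real ^ 'dy \<Rightarrow> real ^ 'du ^ 'dy \<Rightarrow> real ^ 'du" where
  "optimal_solution y G = (ARG_MIN (objective y G) u. True)"

definition spectral_norm :: "real ^ 'du ^ 'dy \<Rightarrow> real" where
  "spectral_norm G = onorm (\<lambda>u. G *v u)"

end

theory Submission
  imports Defs
begin

text \<open>
  The argument is a resisting oracle that answers every query with zero. Run against the zero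
  forward map, the update rule produces certain points \<open>u\<^sub>1, \<dots>, u\<^sub>n\<close>. Since \<open>n < d\<^sub>u\<close>, some unit
  vector \<open>v\<close> is orthogonal to all of them. With \<open>e = y / \<parallel>y\<parallel>\<close>, the two rank-one maps
  \<open>G\<^sub>+ = e v\<^sup>T\<close> and \<open>G\<^sub>- = - e v\<^sup>T\<close> have spectral norm one and vanish at every \<open>u\<^sub>i\<close>, so by
  induction on the number of queries neither can be told apart from the zero map, and the
  algorithm returns one and the same vector \<open>a\<close> for both.

  Their regularized solutions are opposite, namely \<open>\<plusminus> w\<close> with \<open>w = (\<parallel>y\<parallel> / 2) v\<close>, because
  the singular value \<open>\<sigma> = 1\<close> is filtered by the factor \<open>\<sigma> / (\<sigma>\<^sup>2 + 1) = 1 / 2\<close>. As \<open>w\<close> and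
  \<open>- w\<close> are \<open>\<parallel>y\<parallel>\<close> apart, \<open>a\<close> is at distance at least \<open>\<parallel>y\<parallel> / 2\<close> from one of them.
  The lemmas \<open>algorithm_output_cong\<close> and \<open>optimal_solution_outer\<close> carry the two halves.
\<close>

text \<open>
  As long as all answers coincide, the histories coincide, and then so does the next query.
  Agreement at the points queried for \<open>\<G>\<close> therefore suffices, even though the rule is adaptive
  and might, for \<open>\<H>\<close>, have gone elsewhere.
\<close>

lemma admissible_queries_cong:
  assumes "\<And>u. u \<in> set (admissible_queries B y \<G> n) \<Longrightarrow> \<H> u = \<G> u"
  shows "admissible_queries B y \<H> n = admissible_queries B y \<G> n"
  using assms
proof (induction n)
  case 0
  show ?case by simp
next
  case (Suc n)
  then have "admissible_queries B y \<H> n = admissible_queries B y \<G> n"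
    by simp
  moreover have "map (\<lambda>u. (u, \<H> u)) (admissible_queries B y \<G> n)
      = map (\<lambda>u. (u, \<G> u)) (admissible_queries B y \<G> n)"
    using Suc.prems by simp
  ultimately show ?case by (simp only: admissible_queries.simps)
qed

lemma algorithm_output_cong:
  assumes "\<And>u. u \<in> set (admissible_queries B y \<G> n) \<Longrightarrow> \<H> u = \<G> u"
  shows "algorithm_output A B n y \<H> = algorithm_output A B n y \<G>"
proof -
  have "map \<H> (admissible_queries B y \<G> n) = map \<G> (admissible_queries B y \<G> n)"
    using assms by simp
  moreover have "admissible_queries B y \<H> n = admissible_queries B y \<G> n"
    using assms by (rule admissible_queries_cong)
  ultimately show ?thesis
    by (simp only: algorithm_output_def Let_def)
qed

lemma length_admissible_queries: "length (admissible_queries B y \<G> n) = n"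
  by (induction n) auto

lemma exists_unit_orthogonal_to_list:
  fixes us :: "'a::euclidean_space list"
  assumes "length us < DIM('a)"
  obtains v :: 'a where "norm v = 1" and "\<And>u. u \<in> set us \<Longrightarrow> v \<bullet> u = 0"
proof -
  have "dim (set us) \<le> card (set us)"
    by (rule dim_le_card') simp
  also have "\<dots> \<le> length us" by (rule card_length)
  finally have "dim (set us) < DIM('a)" using assms by simp
  then obtain x where x: "x \<noteq> 0" "\<And>u. u \<in> span (set us) \<Longrightarrow> orthogonal x u"
    by (metis orthogonal_to_subspace_exists)
  show thesis
  proof
    show "norm (x /\<^sub>R norm x) = 1" using x by simp
    show "(x /\<^sub>R norm x) \<bullet> u = 0" if "u \<in> set us" for u
      using x(2)[OF span_base[OF that]] by (simp add: orthogonal_def)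
  qed
qed

text \<open>
  The assumption is the normal equation \<open>G\<^sup>T (y - G u\<^sub>0) = u\<^sub>0\<close> in weak form. It cancels the
  first-order term of the quadratic objective at \<open>u\<^sub>0\<close>, so that
  \<open>J u = J u\<^sub>0 + \<parallel>G (u - u\<^sub>0)\<parallel>\<^sup>2 / 2 + \<parallel>u - u\<^sub>0\<parallel>\<^sup>2 / 2\<close>; hence \<open>u\<^sub>0\<close> is a minimizer, and the last
  summand leaves no other.
\<close>

lemma optimal_solution_eqI:
  fixes G :: "real ^ 'du ^ 'dy"
  assumes normal: "\<And>h. (y - G *v u0) \<bullet> (G *v h) = u0 \<bullet> h"
  shows "optimal_solution y G = u0"
proof -
  have expand: "objective y G u
      = objective y G u0 + 1/2 * (norm (G *v (u - u0)))\<^sup>2 + 1/2 * (norm (u - u0))\<^sup>2" for u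
  proof -
    define h where "h = u - u0"
    define r where "r = y - G *v u0"
    have u: "u = u0 + h" by (simp add: h_def)
    have "y - G *v u = r - G *v h"
      by (simp add: u r_def matrix_vector_right_distrib)
    moreover have "(norm (r - G *v h))\<^sup>2 = (norm r)\<^sup>2 - 2 * (u0 \<bullet> h) + (norm (G *v h))\<^sup>2"
      using normal[of h]
      by (simp add: r_def[symmetric] power2_norm_eq_inner inner_diff inner_commute algebra_simps)
    moreover have "(norm u)\<^sup>2 = (norm u0)\<^sup>2 + 2 * (u0 \<bullet> h) + (norm h)\<^sup>2"
      by (simp add: u power2_norm_eq_inner inner_add inner_commute algebra_simps)
    ultimately show ?thesis
      unfolding objective_def h_def[symmetric] r_def[symmetric] by (simp only:) (simp add: field_simps)
  qed
  have "objective y G u0 \<le> objective y G u" for u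
    using expand[of u] by simp
  then have "objective y G (optimal_solution y G) = objective y G u0"
    unfolding optimal_solution_def by (intro arg_min_equality) auto
  then have "(norm (optimal_solution y G - u0))\<^sup>2 \<le> 0"
    using expand[of "optimal_solution y G"]
      zero_le_power2[of "norm (G *v (optimal_solution y G - u0))"] by linarith
  then show ?thesis by simp
qed

definition outer :: "real ^ 'm \<Rightarrow> real ^ 'n \<Rightarrow> real ^ 'n ^ 'm" where
  "outer e v = (\<chi> i j. e $ i * v $ j)"

lemma outer_mult_vec: "outer e v *v u = (v \<bullet> u) *\<^sub>R e"
  by (simp add: outer_def vec_eq_iff matrix_vector_mult_def inner_vec_def
      sum_distrib_left sum_distrib_right mult_ac)

lemma spectral_norm_outer_le: "spectral_norm (outer e v) \<le> norm e * norm v"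
  unfolding spectral_norm_def
proof (rule onorm_le)
  fix u
  have "\<bar>v \<bullet> u\<bar> * norm e \<le> norm v * norm u * norm e"
    by (intro mult_right_mono Cauchy_Schwarz_ineq2) simp
  then show "norm (outer e v *v u) \<le> norm e * norm v * norm u"
    by (simp add: outer_mult_vec mult_ac)
qed

lemma optimal_solution_outer:
  assumes "norm e = 1" and "norm v = 1"
  shows "optimal_solution y (outer e v) = ((y \<bullet> e) / 2) *\<^sub>R v"
proof (rule optimal_solution_eqI)
  have "e \<bullet> e = 1" "v \<bullet> v = 1"
    using assms by (simp_all add: norm_eq_1)
  then show "(y - outer e v *v (((y \<bullet> e) / 2) *\<^sub>R v)) \<bullet> (outer e v *v h)
      = ((y \<bullet> e) / 2) *\<^sub>R v \<bullet> h" for h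
    by (simp add: outer_mult_vec inner_diff_left field_simps)
qed

lemma norm_le_max_dist_opposite:
  fixes a w :: "'a::real_normed_vector"
  shows "norm w \<le> max (norm (a - w)) (norm (a + w))"
proof -
  have "2 * norm w = norm ((a + w) - (a - w))"
    by (simp flip: scaleR_2)
  also have "\<dots> \<le> norm (a + w) + norm (a - w)"
    by (rule norm_triangle_ineq4)
  finally show ?thesis by linarith
qed

theorem proposition3p12:
  fixes y :: "real ^ 'dy"
    and A :: "(real ^ 'du, real ^ 'dy) zeroth_order_algorithm"
    and B :: "(real ^ 'du, real ^ 'dy) update_rule"
    and n :: nat
  assumes "y \<noteq> 0"
    and "real n \<le> real CARD('du) / 2"
  shows "(SUP G \<in> {G :: real ^ 'du ^ 'dy. spectral_norm G \<le> 2}.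
            ereal (norm (algorithm_output A B n y (\<lambda>u. G *v u) - optimal_solution y G)))
         > ereal (0.1 * norm y)"
proof -
  define us where "us = admissible_queries B y (\<lambda>u. 0) n"
  define a where "a = algorithm_output A B n y (\<lambda>u. 0)"
  have "real CARD('du) > 0" by simp
  then have "n < CARD('du)" using assms(2) by linarith
  then have "length us < DIM(real ^ 'du)"
    by (simp add: us_def length_admissible_queries)
  then obtain v where v: "norm v = 1" and orth: "\<And>u. u \<in> set us \<Longrightarrow> v \<bullet> u = 0"
    using exists_unit_orthogonal_to_list by blast
  define e where "e = y /\<^sub>R norm y"
  define w where "w = (norm y / 2) *\<^sub>R v"
  have e: "norm e = 1" using assms(1) by (simp add: e_def)
  have ye: "y \<bullet> e = norm y"
    using assms(1) by (simp add: e_def power2_norm_eq_inner[symmetric] power2_eq_square)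
  have norm_w: "norm w = norm y / 2" using v by (simp add: w_def)
  \<comment> \<open>\<open>- e v\<^sup>T\<close> is written as \<open>e (- v)\<^sup>T\<close>, so that each lemma on \<open>outer\<close> serves both signs.\<close>
  have plus: "algorithm_output A B n y (\<lambda>u. outer e v *v u) = a"
    and minus: "algorithm_output A B n y (\<lambda>u. outer e (- v) *v u) = a"
    unfolding a_def
    by (rule algorithm_output_cong, use orth in \<open>simp add: outer_mult_vec us_def\<close>)+
  have opt: "optimal_solution y (outer e v) = w" "optimal_solution y (outer e (- v)) = - w"
    using optimal_solution_outer[OF e, of v y] optimal_solution_outer[OF e, of "- v" y] v
    by (simp_all add: ye w_def)
  have feasible: "spectral_norm (outer e v) \<le> 2" "spectral_norm (outer e (- v)) \<le> 2"
    using spectral_norm_outer_le[of e v] spectral_norm_outer_le[of e "- v"] e v by simp_all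
  have "0 < norm y" using assms(1) by simp
  then have "0.1 * norm y < norm (a - w) \<or> 0.1 * norm y < norm (a - (- w))"
    using norm_le_max_dist_opposite[of w a] norm_w
    unfolding le_max_iff_disj minus_minus diff_minus_eq_add by linarith
  then show ?thesis
  proof
    assume "0.1 * norm y < norm (a - w)"
    with feasible opt plus show ?thesis
      unfolding less_SUP_iff by (intro bexI[of _ "outer e v"]) auto
  next
    assume "0.1 * norm y < norm (a - (- w))"
    with feasible opt minus show ?thesis
      unfolding less_SUP_iff by (intro bexI[of _ "outer e (- v)"]) auto
  qed
qed

end
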